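(* Let $k\ge 1$, $m\ge 0$ and $s\ge 0$ be integers. Let $q\in\Pi_m^{(k)}$ and let $p\in\Pi^{(k)}$ be a polynomial for which the origin $O=(0,\ldots,0)$ is an $s$-fold zero. Then the PDE $$p(D)f=q$$ has a polynomial solution $f\in\Pi_{m+s}^{(k)}$.
   Context: Polynomials have complex coefficients. For $x=(x_1,\ldots,x_k)$ and a multi-index $\alpha=(\alpha_1,\ldots,\alpha_k)\in\mathbb{Z}_+^k$ write $x^\alpha=x_1^{\alpha_1}\cdots x_k^{\alpha_k}$ and $|\alpha|=\alpha_1+\cdots+\alpha_k$. $\Pi_n^{(k)}=\{\sum_{|\alpha|\le n}a_\alpha x^\alpha\}$ is the space of polynomials in $k$ variables of total degree at most $n$, and $\Pi^{(k)}=\bigcup_{n\ge 0}\Pi_n^{(k)}$. For a polynomial $p$, $p(D)=p\left(\frac{\partial}{\partial x_1},\ldots,\frac{\partial}{\partial x_k}\right)$ is the corresponding constant-coefficient differential operator. For $p=\sum_\alpha a_\alpha x^\alpha$, the $j$th homogeneous layer of $p$ is $p_{(j)}=\sum_{|\alpha|=j}a_\alpha x^\alpha$. The origin is an $s$-fold zero of $p$ if the lowest nonzero homogeneous layer of $p$ is the $s$th one, i.e. $p_{(j)}=0$ for all $j<s$ and $p_{(s)}\ne 0$ (in particular $p\neq 0$; the case $s=0$ means $p(O)\neq 0$). *)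

theory Defs
  imports Complex_Main "HOL-Library.Poly_Mapping"
begin

text \<open>
  Multi-indices are finitely supported functions on \<open>nat\<close>; a polynomial is a finitely
  supported family of complex coefficients indexed by multi-indices (a commutative ring under
  the convolution product of \<open>Poly_Mapping\<close>). The variables \<open>x\<^sub>1, \<dots>, x\<^sub>k\<close> have the
  indices \<open>0, \<dots>, k - 1\<close>; see \<open>Pi_upto\<close>.
\<close>

type_synonym multi_index = "nat \<Rightarrow>\<^sub>0 nat"
type_synonym cpoly = "multi_index \<Rightarrow>\<^sub>0 complex"

definition mdeg :: "multi_index \<Rightarrow> nat" where
  "mdeg \<alpha> = (\<Sum>i\<in>Poly_Mapping.keys \<alpha>. Poly_Mapping.lookup \<alpha> i)"

definition Pi_upto :: "nat \<Rightarrow> nat \<Rightarrow> cpoly set" where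
  "Pi_upto k n = {p. \<forall>\<alpha>\<in>Poly_Mapping.keys p. Poly_Mapping.keys \<alpha> \<subseteq> {..<k} \<and> mdeg \<alpha> \<le> n}"

definition Pi_all :: "nat \<Rightarrow> cpoly set" where
  "Pi_all k = (\<Union>n. Pi_upto k n)"

text \<open>
  Formal partial derivative. If \<open>\<alpha>\<^sub>i = 0\<close>, the truncated subtraction of exponents is harmless
  because the coefficient vanishes.
\<close>

definition partial :: "nat \<Rightarrow> cpoly \<Rightarrow> cpoly" where
  "partial i f = (\<Sum>\<alpha>\<in>Poly_Mapping.keys f.
     Poly_Mapping.single (\<alpha> - Poly_Mapping.single i 1)
       (of_nat (Poly_Mapping.lookup \<alpha> i) * Poly_Mapping.lookup f \<alpha>))"

text \<open>
  The iterated partial derivative \<open>D\<^sup>\<alpha>\<close>. Partial derivatives commute, so the order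
  fixed here is immaterial.
\<close>

definition partials :: "multi_index \<Rightarrow> cpoly \<Rightarrow> cpoly" where
  "partials \<alpha> f = foldr (\<lambda>i. partial i ^^ Poly_Mapping.lookup \<alpha> i)
     (sorted_list_of_set (Poly_Mapping.keys \<alpha>)) f"

text \<open>The operator \<open>p(D)\<close>; the factor \<open>single 0 c\<close> is the constant polynomial \<open>c\<close>.\<close>

definition diff_op :: "cpoly \<Rightarrow> cpoly \<Rightarrow> cpoly" where
  "diff_op p f = (\<Sum>\<alpha>\<in>Poly_Mapping.keys p.
     Poly_Mapping.single 0 (Poly_Mapping.lookup p \<alpha>) * partials \<alpha> f)"

definition layer :: "nat \<Rightarrow> cpoly \<Rightarrow> cpoly" where
  "layer j p = (\<Sum>\<alpha> | \<alpha> \<in> Poly_Mapping.keys p \<and> mdeg \<alpha> = j.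
     Poly_Mapping.single \<alpha> (Poly_Mapping.lookup p \<alpha>))"

definition fold_zero_at_origin :: "nat \<Rightarrow> cpoly \<Rightarrow> bool" where
  "fold_zero_at_origin s p \<longleftrightarrow> (\<forall>j<s. layer j p = 0) \<and> layer s p \<noteq> 0"

end

theory Submission
  imports Defs
begin

text \<open>
  The operator \<open>p(D)\<close> is triangular with respect to a monomial order. Order the
  exponents first by total degree and then lexicographically, and let \<open>\<mu>\<close> be the least
  exponent occurring in \<open>p\<close>. Since the origin is an \<open>s\<close>-fold zero of \<open>p\<close>,
  we have \<open>|\<mu>| = s\<close> (\<open>fold_zero_obtains_least_exponent\<close>).

  The derivative \<open>D\<^sup>\<alpha>\<close> sends \<open>x\<^sup>\<delta>\<close> to a multiple of \<open>x\<^sup>\<gamma>\<close> with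
  \<open>\<gamma> + \<alpha> = \<delta>\<close>, and to \<open>0\<close> if there is no such \<open>\<gamma>\<close>; in the first case
  the factor is a nonzero integer. Take \<open>\<delta> = \<beta> + \<mu>\<close> and let \<open>\<alpha>\<close> run through
  the exponents of \<open>p\<close>. The term \<open>\<alpha> = \<mu>\<close> yields a nonzero multiple of
  \<open>x\<^sup>\<beta>\<close>. Any other \<open>\<alpha>\<close> is larger than \<open>\<mu>\<close>, hence yields an exponent
  \<open>\<gamma>\<close> smaller than \<open>\<beta>\<close>, because the order is compatible with addition. So \<open>x\<^sup>\<beta>\<close>
  is, up to a scalar and smaller monomials, the image of a monomial of degree
  \<open>|\<beta>| + s\<close>. In \<open>k\<close> variables the order is well-founded, and induction shows that each
  monomial of degree at most \<open>m\<close> is the image of a polynomial of degree at most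
  \<open>m + s\<close> (\<open>monomial_in_image\<close>). By linearity the same holds for \<open>q\<close>.
\<close>

section \<open>Multi-indices\<close>

lemma sum_monomials:
  "(\<Sum>x\<in>Poly_Mapping.keys f. Poly_Mapping.single x (Poly_Mapping.lookup f x)) = f"
proof (rule poly_mapping_eqI)
  fix y
  have "Poly_Mapping.lookup (\<Sum>x\<in>Poly_Mapping.keys f. Poly_Mapping.single x (Poly_Mapping.lookup f x)) y
      = (\<Sum>x\<in>Poly_Mapping.keys f. if x = y then Poly_Mapping.lookup f x else 0)"
    unfolding lookup_sum by (simp add: lookup_single when_def)
  then show "Poly_Mapping.lookup (\<Sum>x\<in>Poly_Mapping.keys f.
      Poly_Mapping.single x (Poly_Mapping.lookup f x)) y = Poly_Mapping.lookup f y"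
    by (simp add: in_keys_iff)
qed

lemma mdeg_eq_sum:
  assumes "finite A" "Poly_Mapping.keys \<alpha> \<subseteq> A"
  shows "mdeg \<alpha> = (\<Sum>i\<in>A. Poly_Mapping.lookup \<alpha> i)"
  unfolding mdeg_def using assms
  by (intro sum.mono_neutral_left) (auto simp: in_keys_iff)

lemma keys_add_nat:
  fixes \<alpha> \<beta> :: multi_index
  shows "Poly_Mapping.keys (\<alpha> + \<beta>) = Poly_Mapping.keys \<alpha> \<union> Poly_Mapping.keys \<beta>"
  by (auto simp: in_keys_iff lookup_add)

lemma mdeg_add: "mdeg (\<alpha> + \<beta>) = mdeg \<alpha> + mdeg \<beta>"
proof -
  let ?A = "Poly_Mapping.keys \<alpha> \<union> Poly_Mapping.keys \<beta>"
  have "mdeg \<gamma> = (\<Sum>i\<in>?A. Poly_Mapping.lookup \<gamma> i)" if "\<gamma> \<in> {\<alpha>, \<beta>, \<alpha> + \<beta>}" for \<gamma>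
    using that by (intro mdeg_eq_sum) (auto simp: keys_add_nat)
  then show ?thesis by (simp add: lookup_add sum.distrib)
qed

lemma finite_bounded_mdeg:
  "finite {\<alpha>. Poly_Mapping.keys \<alpha> \<subseteq> {..<k} \<and> mdeg \<alpha> \<le> d}"
proof -
  have "Poly_Mapping.lookup \<alpha> i \<le> d" if "mdeg \<alpha> \<le> d" for \<alpha> i
    using that member_le_sum[of i "Poly_Mapping.keys \<alpha>" "Poly_Mapping.lookup \<alpha>"]
    by (cases "i \<in> Poly_Mapping.keys \<alpha>") (auto simp: mdeg_def in_keys_iff)
  then have "Poly_Mapping.lookup ` {\<alpha>. Poly_Mapping.keys \<alpha> \<subseteq> {..<k} \<and> mdeg \<alpha> \<le> d}
      \<subseteq> {f. \<forall>i. (i \<in> {..<k} \<longrightarrow> f i \<in> {..d}) \<and> (i \<notin> {..<k} \<longrightarrow> f i = 0)}"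
    by (auto simp: in_keys_iff subset_iff)
  then have "finite (Poly_Mapping.lookup ` {\<alpha>. Poly_Mapping.keys \<alpha> \<subseteq> {..<k} \<and> mdeg \<alpha> \<le> d})"
    using finite_set_of_finite_funs[of "{..<k}" "{..d}"] finite_subset by blast
  then show ?thesis
    by (rule finite_imageD) (simp add: inj_on_def poly_mapping_eqI)
qed

text \<open>
  The graded lexicographic order. Its first component is confined to \<open>k\<close> variables because
  in infinitely many variables the order has infinite descending chains, such as
  \<open>x\<^sub>1 > x\<^sub>2 > x\<^sub>3 > \<dots>\<close>.
\<close>

definition grlex :: "nat \<Rightarrow> (multi_index \<times> multi_index) set" where
  "grlex k = {(\<gamma>, \<beta>). Poly_Mapping.keys \<gamma> \<subseteq> {..<k} \<and>
     (mdeg \<gamma> < mdeg \<beta> \<or> mdeg \<gamma> = mdeg \<beta> \<and> \<gamma> < \<beta>)}"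

text \<open>
  A descending step never raises the degree, so below a given exponent there are only finitely
  many exponents in \<open>k\<close> variables.
\<close>

lemma wf_grlex: "wf (grlex k)"
proof (rule wf_finite_segments)
  show "irrefl (grlex k)" by (auto simp: irrefl_def grlex_def)
  show "trans (grlex k)" by (auto simp: trans_def grlex_def)
  show "finite {\<gamma>. (\<gamma>, \<beta>) \<in> grlex k}" for \<beta>
    by (rule finite_subset[OF _ finite_bounded_mdeg[of k "mdeg \<beta>"]]) (auto simp: grlex_def)
qed

section \<open>Coefficients of derivatives\<close>

text \<open>
  Reading off coefficients turns the sum over monomials into a shift of the exponent. The
  truncated subtraction in \<open>partial\<close> can be inverted exactly where \<open>\<alpha>\<^sub>i \<noteq> 0\<close>, and
  the other monomials have derivative \<open>0\<close>.
\<close>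

lemma lookup_partial:
  "Poly_Mapping.lookup (partial i f) \<gamma> =
     of_nat (Suc (Poly_Mapping.lookup \<gamma> i)) * Poly_Mapping.lookup f (\<gamma> + Poly_Mapping.single i 1)"
    (is "?L = ?R")
proof -
  let ?e = "Poly_Mapping.single i (1::nat)"
  have shift: "\<alpha> - ?e = \<gamma> \<longleftrightarrow> \<alpha> = \<gamma> + ?e" if "Poly_Mapping.lookup \<alpha> i \<noteq> 0" for \<alpha>
  proof
    assume "\<alpha> - ?e = \<gamma>"
    then show "\<alpha> = \<gamma> + ?e" using that
      by (auto intro!: poly_mapping_eqI simp: lookup_add lookup_minus lookup_single when_def)
  qed simp
  have "?L = (\<Sum>\<alpha>\<in>Poly_Mapping.keys f.
      if \<alpha> = \<gamma> + ?e then of_nat (Poly_Mapping.lookup \<alpha> i) * Poly_Mapping.lookup f \<alpha> else 0)"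
    unfolding partial_def lookup_sum
  proof (intro sum.cong refl)
    fix \<alpha>
    show "Poly_Mapping.lookup (Poly_Mapping.single (\<alpha> - ?e)
          (of_nat (Poly_Mapping.lookup \<alpha> i) * Poly_Mapping.lookup f \<alpha>)) \<gamma> =
        (if \<alpha> = \<gamma> + ?e then of_nat (Poly_Mapping.lookup \<alpha> i) * Poly_Mapping.lookup f \<alpha> else 0)"
      by (cases "Poly_Mapping.lookup \<alpha> i = 0")
        (auto simp: lookup_single lookup_add when_def shift simp del: One_nat_def)
  qed
  also have "\<dots> = ?R"
    by (simp add: in_keys_iff lookup_add)
  finally show ?thesis .
qed

text \<open>
  The exact coefficient formula for \<open>D\<^sup>\<delta>\<close> is
  \<open>(D\<^sup>\<delta> f)\<^sub>\<gamma> = (\<gamma> + \<delta>)!/\<gamma>! f\<^bsub>\<gamma>+\<delta>\<^esub>\<close>. All that the triangular argument needs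
  of the quotient of factorials is that it is nonzero and independent of \<open>f\<close>, and this
  weaker information is easily carried through compositions.
\<close>

definition scaled_shift :: "multi_index \<Rightarrow> (cpoly \<Rightarrow> cpoly) \<Rightarrow> bool" where
  "scaled_shift \<delta> T \<longleftrightarrow> (\<exists>w. \<forall>\<gamma>. w \<gamma> \<noteq> 0 \<and>
     (\<forall>f. Poly_Mapping.lookup (T f) \<gamma> = w \<gamma> * Poly_Mapping.lookup f (\<gamma> + \<delta>)))"

lemma scaled_shift_comp:
  assumes "scaled_shift \<delta> S" "scaled_shift \<epsilon> T"
  shows "scaled_shift (\<delta> + \<epsilon>) (\<lambda>f. S (T f))"
proof -
  obtain v w where
    "\<And>\<gamma>. v \<gamma> \<noteq> 0" "\<And>\<gamma> f. Poly_Mapping.lookup (S f) \<gamma> = v \<gamma> * Poly_Mapping.lookup f (\<gamma> + \<delta>)"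
    "\<And>\<gamma>. w \<gamma> \<noteq> 0" "\<And>\<gamma> f. Poly_Mapping.lookup (T f) \<gamma> = w \<gamma> * Poly_Mapping.lookup f (\<gamma> + \<epsilon>)"
    using assms unfolding scaled_shift_def by metis
  then show ?thesis unfolding scaled_shift_def
    by (intro exI[of _ "\<lambda>\<gamma>. v \<gamma> * w (\<gamma> + \<delta>)"]) (simp add: add.assoc)
qed

lemma scaled_shift_id: "scaled_shift 0 (\<lambda>f. f)"
  unfolding scaled_shift_def by (intro exI[of _ "\<lambda>_. 1"]) simp

lemma scaled_shift_partial: "scaled_shift (Poly_Mapping.single i 1) (partial i)"
  unfolding scaled_shift_def lookup_partial
  by (intro exI[of _ "\<lambda>\<gamma>. of_nat (Suc (Poly_Mapping.lookup \<gamma> i))"]) (simp del: of_nat_Suc)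

lemma scaled_shift_partial_funpow:
  "scaled_shift (Poly_Mapping.single i n) (partial i ^^ n)"
proof (induction n)
  case 0
  then show ?case by (simp add: scaled_shift_id id_def)
next
  case (Suc n)
  from scaled_shift_comp[OF scaled_shift_partial[of i] this]
  show ?case by (simp add: comp_def flip: single_add)
qed

lemma scaled_shift_partials: "scaled_shift \<alpha> (partials \<alpha>)"
proof -
  have foldr: "scaled_shift (\<Sum>i\<leftarrow>xs. Poly_Mapping.single i (Poly_Mapping.lookup \<alpha> i))
      (foldr (\<lambda>i. partial i ^^ Poly_Mapping.lookup \<alpha> i) xs)" for xs
    by (induction xs)
      (simp_all add: id_def comp_def scaled_shift_id scaled_shift_comp scaled_shift_partial_funpow)
  have "(\<Sum>i\<leftarrow>sorted_list_of_set (Poly_Mapping.keys \<alpha>).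
      Poly_Mapping.single i (Poly_Mapping.lookup \<alpha> i)) = \<alpha>"
    by (simp add: sum_list_distinct_conv_sum_set sum_monomials)
  with foldr[of "sorted_list_of_set (Poly_Mapping.keys \<alpha>)"] show ?thesis
    by (simp add: partials_def[abs_def])
qed

lemma lookup_const_mult:
  fixes f :: cpoly
  shows "Poly_Mapping.lookup (Poly_Mapping.single 0 c * f) \<gamma> = c * Poly_Mapping.lookup f \<gamma>"
  unfolding mult_map_scale_conv_mult[symmetric]
  by (simp add: Poly_Mapping.map.rep_eq when_def)

lemma lookup_diff_op:
  obtains w where "\<And>\<alpha> \<gamma>. w \<alpha> \<gamma> \<noteq> 0"
    and "\<And>p f \<gamma>. Poly_Mapping.lookup (diff_op p f) \<gamma> =
      (\<Sum>\<alpha>\<in>Poly_Mapping.keys p. Poly_Mapping.lookup p \<alpha> * w \<alpha> \<gamma> * Poly_Mapping.lookup f (\<gamma> + \<alpha>))"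
proof -
  from scaled_shift_partials obtain w where
    "\<And>\<alpha> \<gamma>. w \<alpha> \<gamma> \<noteq> 0"
    "\<And>\<alpha> f \<gamma>. Poly_Mapping.lookup (partials \<alpha> f) \<gamma> = w \<alpha> \<gamma> * Poly_Mapping.lookup f (\<gamma> + \<alpha>)"
    unfolding scaled_shift_def by metis
  then show ?thesis
    by (intro that[of w]) (simp_all add: diff_op_def lookup_sum lookup_const_mult mult.assoc)
qed

lemma diff_op_add: "diff_op p (f + g) = diff_op p f + diff_op p g"
proof -
  obtain w where "\<And>p f \<gamma>. Poly_Mapping.lookup (diff_op p f) \<gamma> =
      (\<Sum>\<alpha>\<in>Poly_Mapping.keys p. Poly_Mapping.lookup p \<alpha> * w \<alpha> \<gamma> * Poly_Mapping.lookup f (\<gamma> + \<alpha>))"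
    using lookup_diff_op by metis
  then show ?thesis
    by (intro poly_mapping_eqI) (simp add: lookup_add distrib_left sum.distrib)
qed

lemma diff_op_zero: "diff_op p 0 = 0"
  using diff_op_add[of p 0 0] by simp

section \<open>Zeros at the origin and the leading exponent\<close>

lemma lookup_layer:
  "Poly_Mapping.lookup (layer j p) \<gamma> = (if mdeg \<gamma> = j then Poly_Mapping.lookup p \<gamma> else 0)"
proof -
  have "Poly_Mapping.lookup (layer j p) \<gamma> =
      (\<Sum>\<alpha> | \<alpha> \<in> Poly_Mapping.keys p \<and> mdeg \<alpha> = j. if \<alpha> = \<gamma> then Poly_Mapping.lookup p \<alpha> else 0)"
    unfolding layer_def lookup_sum by (simp add: lookup_single when_def)
  then show ?thesis by (simp add: in_keys_iff)
qed

lemma fold_zero_obtains_least_exponent: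
  assumes "fold_zero_at_origin s p"
  obtains \<mu> where "\<mu> \<in> Poly_Mapping.keys p" "mdeg \<mu> = s"
    "\<And>\<alpha>. \<alpha> \<in> Poly_Mapping.keys p \<Longrightarrow> mdeg \<mu> < mdeg \<alpha> \<or> mdeg \<mu> = mdeg \<alpha> \<and> \<mu> \<le> \<alpha>"
proof -
  define A where "A = {\<alpha> \<in> Poly_Mapping.keys p. mdeg \<alpha> = s}"
  have low: "s \<le> mdeg \<alpha>" if "\<alpha> \<in> Poly_Mapping.keys p" for \<alpha>
  proof (rule ccontr)
    assume "\<not> s \<le> mdeg \<alpha>"
    with assms have "layer (mdeg \<alpha>) p = 0" by (simp add: fold_zero_at_origin_def)
    then show False using that lookup_layer[of "mdeg \<alpha>" p \<alpha>] by (simp add: in_keys_iff)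
  qed
  obtain \<alpha> where "Poly_Mapping.lookup (layer s p) \<alpha> \<noteq> 0"
    using assms poly_mapping_eqI[of "layer s p" 0] by (auto simp: fold_zero_at_origin_def)
  then have "A \<noteq> {}"
    by (auto simp: A_def lookup_layer in_keys_iff split: if_splits)
  moreover have "finite A" by (simp add: A_def)
  ultimately have "Min A \<in> A" "\<And>\<alpha>. \<alpha> \<in> A \<Longrightarrow> Min A \<le> \<alpha>" by simp_all
  with low show ?thesis by (intro that[of "Min A"]) (fastforce simp: A_def)+
qed

section \<open>Solving the equation\<close>

lemma Pi_upto_zero: "0 \<in> Pi_upto k n"
  by (simp add: Pi_upto_def)

lemma Pi_upto_add: "f \<in> Pi_upto k n \<Longrightarrow> g \<in> Pi_upto k n \<Longrightarrow> f + g \<in> Pi_upto k n"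
  using Poly_Mapping.keys_add[of f g] unfolding Pi_upto_def by blast

text \<open>
  The image of \<open>p(D)\<close> is closed under sums. The hypothesis allows an arbitrary coefficient
  \<open>c\<close>, so that closure under scalar multiples does not have to be treated separately.
\<close>

lemma in_image_if_monomials:
  fixes q :: cpoly
  assumes "\<And>\<gamma> c. \<gamma> \<in> Poly_Mapping.keys q \<Longrightarrow>
    Poly_Mapping.single \<gamma> c \<in> diff_op p ` Pi_upto k n"
  shows "q \<in> diff_op p ` Pi_upto k n"
proof -
  have zero: "0 \<in> diff_op p ` Pi_upto k n"
    using Pi_upto_zero by (metis diff_op_zero image_eqI)
  have add: "f + g \<in> diff_op p ` Pi_upto k n"
    if "f \<in> diff_op p ` Pi_upto k n" "g \<in> diff_op p ` Pi_upto k n" for f g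
    using that by (auto simp flip: diff_op_add intro: Pi_upto_add)
  have "(\<Sum>\<gamma>\<in>A. Poly_Mapping.single \<gamma> (Poly_Mapping.lookup q \<gamma>)) \<in> diff_op p ` Pi_upto k n"
    if "finite A" "A \<subseteq> Poly_Mapping.keys q" for A
    using that by (induction A rule: finite_induct) (auto simp: zero intro!: add assms)
  from this[of "Poly_Mapping.keys q"] show ?thesis
    by (simp add: sum_monomials)
qed

text \<open>
  One step of back substitution: the image of a suitable multiple of \<open>x\<^bsup>\<beta>+\<mu>\<^esup>\<close> agrees
  with \<open>c x\<^sup>\<beta>\<close> in the coefficient of \<open>x\<^sup>\<beta>\<close>, and the remaining error \<open>h\<close> has only
  smaller exponents, so it is in the image by induction.
\<close>

lemma monomial_in_image:
  assumes \<mu>: "\<mu> \<in> Poly_Mapping.keys p" "mdeg \<mu> = s"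
      "\<And>\<alpha>. \<alpha> \<in> Poly_Mapping.keys p \<Longrightarrow> mdeg \<mu> < mdeg \<alpha> \<or> mdeg \<mu> = mdeg \<alpha> \<and> \<mu> \<le> \<alpha>"
    and k: "Poly_Mapping.keys \<mu> \<subseteq> {..<k}"
    and \<beta>: "Poly_Mapping.keys \<beta> \<subseteq> {..<k}" "mdeg \<beta> \<le> m"
  shows "Poly_Mapping.single \<beta> c \<in> diff_op p ` Pi_upto k (m + s)"
  using \<beta>
proof (induction \<beta> arbitrary: c rule: wf_induct_rule[OF wf_grlex[of k]])
  case (1 \<beta>)
  obtain w where w: "\<And>\<alpha> \<gamma>. w \<alpha> \<gamma> \<noteq> 0"
    "\<And>p f \<gamma>. Poly_Mapping.lookup (diff_op p f) \<gamma> =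
      (\<Sum>\<alpha>\<in>Poly_Mapping.keys p. Poly_Mapping.lookup p \<alpha> * w \<alpha> \<gamma> * Poly_Mapping.lookup f (\<gamma> + \<alpha>))"
    using lookup_diff_op by metis
  define f where "f = Poly_Mapping.single (\<beta> + \<mu>) (c / (Poly_Mapping.lookup p \<mu> * w \<mu> \<beta>))"
  define h where "h = Poly_Mapping.single \<beta> c - diff_op p f"
  have f: "f \<in> Pi_upto k (m + s)"
    using 1 \<mu> k by (auto simp: f_def Pi_upto_def keys_add_nat mdeg_add)
  \<comment> \<open>The exponent \<open>\<beta>\<close> is reached from \<open>\<beta> + \<mu>\<close> only through \<open>\<alpha> = \<mu>\<close>.\<close>
  have "Poly_Mapping.lookup (diff_op p f) \<beta> =
      (\<Sum>\<alpha>\<in>Poly_Mapping.keys p. if \<alpha> = \<mu> then c else 0)"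
    unfolding w(2) using \<mu>(1) w(1)
    by (intro sum.cong) (auto simp: f_def lookup_single when_def in_keys_iff)
  then have lead: "\<beta> \<notin> Poly_Mapping.keys h"
    using \<mu>(1) by (simp add: h_def in_keys_iff lookup_minus)
  have smaller: "(\<gamma>, \<beta>) \<in> grlex k" if "\<gamma> \<in> Poly_Mapping.keys h" for \<gamma>
  proof -
    from that lead have "\<gamma> \<noteq> \<beta>" by auto
    with that have "Poly_Mapping.lookup (diff_op p f) \<gamma> \<noteq> 0"
      by (simp add: h_def in_keys_iff lookup_minus lookup_single)
    then obtain \<alpha> where \<alpha>: "\<alpha> \<in> Poly_Mapping.keys p" "\<gamma> + \<alpha> = \<beta> + \<mu>"
      unfolding w(2)
      by (auto simp: f_def lookup_single when_def
          elim!: sum.not_neutral_contains_not_neutral split: if_splits)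
    have "Poly_Mapping.keys \<gamma> \<subseteq> {..<k}"
      using arg_cong[OF \<alpha>(2), of Poly_Mapping.keys] 1(2) k by (auto simp: keys_add_nat)
    moreover have "mdeg \<gamma> + mdeg \<alpha> = mdeg \<beta> + mdeg \<mu>"
      using arg_cong[OF \<alpha>(2), of mdeg] by (simp add: mdeg_add)
    moreover have "\<gamma> < \<beta>" if "\<mu> \<le> \<alpha>"
    proof (rule ccontr)
      assume "\<not> \<gamma> < \<beta>"
      with \<open>\<gamma> \<noteq> \<beta>\<close> have "\<beta> < \<gamma>" by (meson linorder_neqE)
      from this that have "\<beta> + \<mu> < \<gamma> + \<alpha>" by (rule add_less_le_mono)
      with \<alpha>(2) show False by simp
    qed
    ultimately show ?thesis using \<mu>(3)[OF \<alpha>(1)] by (auto simp: grlex_def)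
  qed
  have "h \<in> diff_op p ` Pi_upto k (m + s)"
  proof (rule in_image_if_monomials)
    fix \<gamma> c' assume "\<gamma> \<in> Poly_Mapping.keys h"
    then have "(\<gamma>, \<beta>) \<in> grlex k" by (rule smaller)
    with 1 show "Poly_Mapping.single \<gamma> c' \<in> diff_op p ` Pi_upto k (m + s)"
      by (auto simp: grlex_def)
  qed
  then obtain g where g: "g \<in> Pi_upto k (m + s)" "h = diff_op p g" by blast
  show ?case
  proof (rule image_eqI)
    show "Poly_Mapping.single \<beta> c = diff_op p (f + g)"
      by (simp add: diff_op_add h_def flip: g(2))
    show "f + g \<in> Pi_upto k (m + s)"
      using f g(1) by (rule Pi_upto_add)
  qed
qed

theorem theorem3p1:
  fixes k m s :: nat and p q :: cpoly
  assumes "k \<ge> 1"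
    and "q \<in> Pi_upto k m"
    and "p \<in> Pi_all k"
    and "fold_zero_at_origin s p"
  shows "\<exists>f \<in> Pi_upto k (m + s). diff_op p f = q"
proof -
  from assms(4) obtain \<mu> where \<mu>: "\<mu> \<in> Poly_Mapping.keys p" "mdeg \<mu> = s"
    "\<And>\<alpha>. \<alpha> \<in> Poly_Mapping.keys p \<Longrightarrow> mdeg \<mu> < mdeg \<alpha> \<or> mdeg \<mu> = mdeg \<alpha> \<and> \<mu> \<le> \<alpha>"
    using fold_zero_obtains_least_exponent by blast
  with assms(3) have k: "Poly_Mapping.keys \<mu> \<subseteq> {..<k}"
    by (auto simp: Pi_all_def Pi_upto_def)
  have "q \<in> diff_op p ` Pi_upto k (m + s)"
  proof (rule in_image_if_monomials)
    fix \<gamma> c assume "\<gamma> \<in> Poly_Mapping.keys q"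
    with assms(2) have "Poly_Mapping.keys \<gamma> \<subseteq> {..<k}" "mdeg \<gamma> \<le> m"
      by (auto simp: Pi_upto_def)
    with \<mu> k show "Poly_Mapping.single \<gamma> c \<in> diff_op p ` Pi_upto k (m + s)"
      by (rule monomial_in_image)
  qed
  then show ?thesis by auto
qed

end
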